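(* Let $\beta$ be non-zero and purely imaginary. Then for any natural number $m>2$ there exist positive constants $A,B$ such that $$|H_m^{\beta}(x)|\leq\frac{A}{|x|^{\frac{m-2}{2(m-1)}}}+\frac{B}{|x|}$$ for all non-zero $x\in\mathbb{R}$.
   Context: For a natural number $m>2$ and non-zero purely imaginary $\beta$, $H_m^{\beta}:\mathbb{R}\to\mathbb{C}$ is defined by the (convergent) improper Riemann integral $H_m^{\beta}(x)=\frac{1}{2\pi}\int_{\mathbb{R}}e^{-ixu}e^{-\beta u^m}\,du$. *)

theory Defs
  imports "HOL-Analysis.Analysis"
begin

(* The integral is the (gauge) integral over the whole line. For a continuous integrand
   this is the improper Riemann integral, with both endpoints tending to infinity
   independently: see has_integral_UNIV_iff_improper. Note that for purely imaginary
   beta the integrand has modulus 1, so a Lebesgue integral would not do. *)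
definition H :: "nat \<Rightarrow> complex \<Rightarrow> real \<Rightarrow> complex" where
  "H m \<beta> x = 1 / (2 * of_real pi) *
     integral UNIV (\<lambda>u::real. exp (- \<i> * of_real x * of_real u) * exp (- \<beta> * of_real u ^ m))"

lemma has_integral_UNIV_iff_improper:
  fixes f :: "real \<Rightarrow> complex"
  assumes cont: "continuous_on UNIV f"
  shows "(f has_integral I) UNIV \<longleftrightarrow>
    ((\<lambda>(a, b). integral {a..b} f) \<longlongrightarrow> I) (at_bot \<times>\<^sub>F at_top)"
proof -
  have int: "f integrable_on {a..b}" for a b
    by (rule integrable_continuous_interval) (use cont continuous_on_subset in blast)
  have ball: "a \<le> -B \<and> B \<le> b" if "ball 0 B \<subseteq> {a..b}" "B > 0" for a b B :: real
  proof -
    have "{-B<..<B} \<subseteq> {a..b}"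
      using that(1) by (simp add: ball_eq_greaterThanLessThan)
    then show ?thesis
      using that(2) by (simp add: greaterThanLessThan_subseteq_atLeastAtMost_iff)
  qed
  show ?thesis
  proof
    assume L: "(f has_integral I) UNIV"
    show "((\<lambda>(a, b). integral {a..b} f) \<longlongrightarrow> I) (at_bot \<times>\<^sub>F at_top)"
    proof (rule tendstoI)
      fix e :: real assume "e > 0"
      then obtain B where B: "B > 0"
        "\<And>a b. ball 0 B \<subseteq> {a..b} \<Longrightarrow> norm (integral {a..b} f - I) < e"
        using L unfolding has_integral_alt'[of f] by auto
      have "ball 0 B \<subseteq> {a..b}" if "a \<le> -B" "B \<le> b" for a b
        using that by (auto simp: ball_eq_greaterThanLessThan)
      then have "dist (integral {a..b} f) I < e" if "a \<le> -B" "B \<le> b" for a b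
        using B(2) that by (simp add: dist_norm)
      then show "\<forall>\<^sub>F p in at_bot \<times>\<^sub>F at_top. dist (case p of (a, b) \<Rightarrow> integral {a..b} f) I < e"
        unfolding eventually_prod_filter
        by (intro exI[of _ "\<lambda>a. a \<le> -B"] exI[of _ "\<lambda>b. B \<le> b"])
           (auto simp: eventually_le_at_bot eventually_ge_at_top)
    qed
  next
    assume R: "((\<lambda>(a, b). integral {a..b} f) \<longlongrightarrow> I) (at_bot \<times>\<^sub>F at_top)"
    have "\<exists>B>0. \<forall>a b. ball 0 B \<subseteq> {a..b} \<longrightarrow> norm (integral {a..b} f - I) < e" if e: "e > 0" for e
    proof -
      obtain P Q where PQ: "eventually P at_bot" "eventually Q at_top"
        "\<And>a b. P a \<Longrightarrow> Q b \<Longrightarrow> dist (integral {a..b} f) I < e"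
        using tendstoD[OF R e] unfolding eventually_prod_filter by auto
      obtain s t where "\<And>a. a \<le> s \<Longrightarrow> P a" "\<And>b. t \<le> b \<Longrightarrow> Q b"
        using PQ(1,2) unfolding eventually_at_bot_linorder eventually_at_top_linorder by blast
      then have st: "norm (integral {a..b} f - I) < e" if "a \<le> s" "t \<le> b" for a b
        using PQ(3) that by (simp add: dist_norm)
      define B where "B = Max {1, -s, t}"
      have "B > 0" "- B \<le> s" "t \<le> B"
        by (auto simp: B_def)
      then show ?thesis
        using ball st by (meson order_trans)
    qed
    then show "(f has_integral I) UNIV"
      unfolding has_integral_alt'[of f] using int by simp
  qed
qed

end

theory Submission
  imports Defs
begin

text \<open>
  Since \<open>\<beta>\<close> is purely imaginary, \<open>H m \<beta> x\<close> is up to the factor \<open>1 / (2 * pi)\<close> an oscillatory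
  integral with the real phase \<open>\<phi> u = y * u + b * u ^ m\<close>, where \<open>y = - x\<close> and \<open>b = - Im \<beta>\<close>.
  Its integrand has modulus 1, so any decay comes from cancellation, which the two
  van der Corput estimates measure: if \<open>\<phi>'\<close> is monotone and bounded away from zero by
  \<open>\<delta>\<close>, the integral is \<open>O(1 / \<delta>)\<close> (\<open>van_der_Corput_first\<close>); if \<open>\<phi>'' \<ge> \<kappa> > 0\<close>, it is
  \<open>O(1 / sqrt \<kappa>)\<close>, even across a stationary point (\<open>van_der_Corput_second\<close>). Both bounds
  are uniform in the length of the interval, and therefore survive the passage to the improper
  integral.

  Reflection and complex conjugation reduce the problem to the half-line \<open>u \<ge> 0\<close> with \<open>b > 0\<close>.
  There the two terms of \<open>\<phi>'\<close> have equal modulus exactly at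
  \<open>\<rho> = (\<bar>y\<bar> / (m * b)) powr (1 / (m - 1))\<close>, the only possible stationary point. On
  \<open>{0..\<rho> / 2}\<close> the linear term dominates, so \<open>\<bar>\<phi>'\<bar> \<ge> \<bar>y\<bar> / 2\<close>, and the first estimate gives
  \<open>B / \<bar>x\<bar>\<close>. Beyond \<open>\<rho> / 2\<close> the second derivative is at least a multiple of \<open>\<rho> ^ (m - 2)\<close>, and
  the second estimate gives a multiple of \<open>\<rho> powr (- (m - 2) / 2)\<close>, that is, of
  \<open>\<bar>x\<bar> powr (- (m - 2) / (2 * (m - 1)))\<close>.
\<close>

section \<open>The van der Corput estimates\<close>

lemma integrable_cis_differentiable_phase:
  fixes \<phi> \<phi>' :: "real \<Rightarrow> real"
  assumes "\<And>u. u \<in> {a..c} \<Longrightarrow> (\<phi> has_real_derivative \<phi>' u) (at u)"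
  shows "(\<lambda>u. cis (\<phi> u)) integrable_on {a..c}"
  using assms
  by (intro integrable_continuous_interval continuous_on_cis DERIV_continuous_on[where D = \<phi>'])
     (auto intro: has_field_derivative_at_within)

text \<open>
  Integration by parts after writing \<open>cis \<phi> = (cis \<phi>)' / (\<i> * \<phi>')\<close>. The boundary terms have
  modulus at most \<open>1 / \<delta>\<close> each. The remaining integrand has modulus \<open>\<phi>'' / \<phi>'\<^sup>2\<close> because \<open>\<phi>''\<close>
  has a fixed sign, and this is the exact derivative of \<open>- 1 / \<phi>'\<close>, so it contributes at
  most \<open>2 / \<delta>\<close> whatever the length of the interval.
\<close>

lemma van_der_Corput_first:
  fixes \<phi> \<phi>' \<phi>'' :: "real \<Rightarrow> real"
  assumes "a \<le> c" "\<delta> > 0"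
    and d1: "\<And>u. u \<in> {a..c} \<Longrightarrow> (\<phi> has_real_derivative \<phi>' u) (at u)"
    and d2: "\<And>u. u \<in> {a..c} \<Longrightarrow> (\<phi>' has_real_derivative \<phi>'' u) (at u)"
    and convex: "\<And>u. u \<in> {a..c} \<Longrightarrow> \<phi>'' u \<ge> 0"
    and big: "\<And>u. u \<in> {a..c} \<Longrightarrow> \<bar>\<phi>' u\<bar> \<ge> \<delta>"
  shows "norm (integral {a..c} (\<lambda>u. cis (\<phi> u))) \<le> 4 / \<delta>"
proof -
  \<comment> \<open>\<open>F\<close> is the boundary term \<open>cis \<phi> / (\<i> * \<phi>')\<close>, and \<open>g\<close> is the error in
    \<open>F' = cis \<phi> + g\<close>.\<close>
  define F where "F = (\<lambda>u. - \<i> * cis (\<phi> u) * of_real (1 / \<phi>' u))"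
  define g where "g = (\<lambda>u. \<i> * cis (\<phi> u) * of_real (\<phi>'' u / (\<phi>' u)\<^sup>2))"
  have nz: "\<phi>' u \<noteq> 0" if "u \<in> {a..c}" for u
    using big[OF that] \<open>\<delta> > 0\<close> by auto
  have dinv: "((\<lambda>u. 1 / \<phi>' u) has_real_derivative - (\<phi>'' u / (\<phi>' u)\<^sup>2)) (at u)"
    if "u \<in> {a..c}" for u
    using d2[OF that] nz[OF that]
    by (auto intro!: derivative_eq_intros simp: power2_eq_square)
  have dcis: "((\<lambda>u. cis (\<phi> u)) has_vector_derivative (of_real (\<phi>' u) * (\<i> * cis (\<phi> u))))
      (at u)" if "u \<in> {a..c}" for u
    using has_derivative_cis[OF d1[OF that, unfolded has_field_derivative_def]]
    by (simp add: has_vector_derivative_def scaleR_conv_of_real mult_ac)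
  have dF: "(F has_vector_derivative (cis (\<phi> u) + g u)) (at u)"
    if "u \<in> {a..c}" for u
  proof -
    have "((\<lambda>u. complex_of_real (1 / \<phi>' u)) has_vector_derivative
        of_real (- (\<phi>'' u / (\<phi>' u)\<^sup>2))) (at u)"
      using dinv[OF that]
      by (intro has_vector_derivative_of_real)
         (simp add: has_real_derivative_iff_has_vector_derivative)
    from has_vector_derivative_mult[OF has_vector_derivative_mult_right[OF dcis[OF that], of "-\<i>"] this]
    show ?thesis
      using nz[OF that] unfolding F_def g_def by (simp add: algebra_simps)
  qed
  have int_sum: "((\<lambda>u. cis (\<phi> u) + g u) has_integral (F c - F a)) {a..c}"
    by (rule fundamental_theorem_of_calculus)
       (use \<open>a \<le> c\<close> dF in \<open>auto intro: has_vector_derivative_at_within\<close>)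
  have int_cis: "(\<lambda>u. cis (\<phi> u)) integrable_on {a..c}"
    using d1 by (rule integrable_cis_differentiable_phase)
  have int_g: "(g has_integral (F c - F a - integral {a..c} (\<lambda>u. cis (\<phi> u)))) {a..c}"
    using has_integral_diff[OF int_sum integrable_integral[OF int_cis]] by simp
  have int_bd: "((\<lambda>u. \<phi>'' u / (\<phi>' u)\<^sup>2) has_integral (1 / \<phi>' a - 1 / \<phi>' c)) {a..c}"
  proof -
    have "((\<lambda>u. - (\<phi>'' u / (\<phi>' u)\<^sup>2)) has_integral (1 / \<phi>' c - 1 / \<phi>' a)) {a..c}"
      by (rule fundamental_theorem_of_calculus)
         (use \<open>a \<le> c\<close> dinv in \<open>auto intro: has_field_derivative_at_within
            simp flip: has_real_derivative_iff_has_vector_derivative\<close>)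
    from has_integral_neg[OF this] show ?thesis by simp
  qed
  have "norm (integral {a..c} g) \<le> integral {a..c} (\<lambda>u. \<phi>'' u / (\<phi>' u)\<^sup>2)"
    by (rule integral_norm_bound_integral)
       (use int_g int_bd convex in \<open>auto simp: g_def norm_mult norm_divide norm_power\<close>)
  then have g_le: "norm (F c - F a - integral {a..c} (\<lambda>u. cis (\<phi> u))) \<le> 1 / \<phi>' a - 1 / \<phi>' c"
    using int_g int_bd by (simp add: integral_unique)
  have inv_le: "\<bar>1 / \<phi>' u\<bar> \<le> 1 / \<delta>" if "u \<in> {a..c}" for u
    using big[OF that] \<open>\<delta> > 0\<close> nz[OF that] by (simp add: frac_le)
  have F_le: "norm (F u) \<le> 1 / \<delta>" if "u \<in> {a..c}" for u
    using inv_le[OF that] by (simp add: F_def norm_mult norm_divide)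
  have "norm (integral {a..c} (\<lambda>u. cis (\<phi> u)))
      \<le> norm (F c) + norm (F a) + norm (F c - F a - integral {a..c} (\<lambda>u. cis (\<phi> u)))"
    by norm
  also have "\<dots> \<le> 4 * (1 / \<delta>)"
  proof -
    have "a \<in> {a..c}" "c \<in> {a..c}"
      using \<open>a \<le> c\<close> by auto
    from F_le[OF this(1)] F_le[OF this(2)] inv_le[OF this(1)] inv_le[OF this(2)] g_le
    show ?thesis
      by linarith
  qed
  finally show ?thesis by simp
qed

lemma norm_integral_cis_le:
  fixes \<phi> :: "real \<Rightarrow> real"
  assumes "a \<le> c"
  shows "norm (integral {a..c} (\<lambda>u. cis (\<phi> u))) \<le> c - a"
proof (cases "(\<lambda>u. cis (\<phi> u)) integrable_on {a..c}")
  case True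
  then show ?thesis
    using integral_norm_bound_integral[OF True integrable_const_ivl, of 1] assms by simp
qed (use assms in \<open>simp add: not_integrable_integral\<close>)

text \<open>
  As \<open>\<phi>'\<close> starts nonnegative and grows at rate at least \<open>\<kappa>\<close>, it exceeds \<open>sqrt \<kappa>\<close> after
  length \<open>1 / sqrt \<kappa>\<close>. The initial piece is bounded by its length, the rest by the first estimate
  with \<open>\<delta> = sqrt \<kappa>\<close>; this cut makes both bounds of order \<open>1 / sqrt \<kappa>\<close>.
\<close>

lemma van_der_Corput_second_increasing:
  fixes \<phi> \<phi>' \<phi>'' :: "real \<Rightarrow> real"
  assumes "a \<le> c" "\<kappa> > 0"
    and d1: "\<And>u. u \<in> {a..c} \<Longrightarrow> (\<phi> has_real_derivative \<phi>' u) (at u)"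
    and d2: "\<And>u. u \<in> {a..c} \<Longrightarrow> (\<phi>' has_real_derivative \<phi>'' u) (at u)"
    and big: "\<And>u. u \<in> {a..c} \<Longrightarrow> \<phi>'' u \<ge> \<kappa>"
    and nonneg: "\<phi>' a \<ge> 0"
  shows "norm (integral {a..c} (\<lambda>u. cis (\<phi> u))) \<le> 5 / sqrt \<kappa>"
proof (cases "c \<le> a + 1 / sqrt \<kappa>")
  case True
  have "norm (integral {a..c} (\<lambda>u. cis (\<phi> u))) \<le> c - a"
    by (rule norm_integral_cis_le) fact
  also have "\<dots> \<le> 1 / sqrt \<kappa>"
    using True by simp
  also have "\<dots> \<le> 5 / sqrt \<kappa>"
    using \<open>\<kappa> > 0\<close> by (simp add: divide_right_mono)
  finally show ?thesis .
next
  case False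
  define z where "z = a + 1 / sqrt \<kappa>"
  have z: "a < z" "z \<le> c"
    using False \<open>\<kappa> > 0\<close> by (auto simp: z_def)
  have grow: "\<phi>' u \<ge> sqrt \<kappa>" if u: "u \<in> {z..c}" for u
  proof -
    have "a < u"
      using u z by auto
    then obtain v where v: "a < v" "v < u" "\<phi>' u - \<phi>' a = (u - a) * \<phi>'' v"
      using MVT2[of a u \<phi>' \<phi>''] d2 u by auto
    have "sqrt \<kappa> = (1 / sqrt \<kappa>) * \<kappa>"
      using \<open>\<kappa> > 0\<close> by (simp add: real_div_sqrt)
    also have "\<dots> \<le> (u - a) * \<phi>'' v"
      using u v \<open>\<kappa> > 0\<close> big[of v] by (intro mult_mono) (auto simp: z_def)
    finally show ?thesis
      using v nonneg by linarith
  qed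
  have "(\<lambda>u. cis (\<phi> u)) integrable_on {a..c}"
    using d1 by (rule integrable_cis_differentiable_phase)
  then have "integral {a..c} (\<lambda>u. cis (\<phi> u)) =
      integral {a..z} (\<lambda>u. cis (\<phi> u)) + integral {z..c} (\<lambda>u. cis (\<phi> u))"
    using z by (simp add: Henstock_Kurzweil_Integration.integral_combine)
  also have "norm \<dots> \<le> (z - a) + 4 / sqrt \<kappa>"
  proof (intro norm_triangle_mono)
    show "norm (integral {a..z} (\<lambda>u. cis (\<phi> u))) \<le> z - a"
      by (rule norm_integral_cis_le) (use z in auto)
    show "norm (integral {z..c} (\<lambda>u. cis (\<phi> u))) \<le> 4 / sqrt \<kappa>"
    proof (rule van_der_Corput_first)
      fix u assume u: "u \<in> {z..c}"
      then have u': "u \<in> {a..c}"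
        using z by auto
      show "(\<phi> has_real_derivative \<phi>' u) (at u)" "(\<phi>' has_real_derivative \<phi>'' u) (at u)"
        using d1 d2 u' by auto
      show "0 \<le> \<phi>'' u"
        using big[OF u'] \<open>\<kappa> > 0\<close> by linarith
      show "sqrt \<kappa> \<le> \<bar>\<phi>' u\<bar>"
        using grow[OF u] by linarith
    qed (use z \<open>\<kappa> > 0\<close> in auto)
  qed
  also have "\<dots> = 5 / sqrt \<kappa>"
    by (simp add: z_def)
  finally show ?thesis .
qed

text \<open>
  The mirror image: \<open>u \<mapsto> - u\<close> keeps \<open>\<phi>''\<close> and changes the sign of \<open>\<phi>'\<close>.
\<close>

lemma van_der_Corput_second_decreasing:
  fixes \<phi> \<phi>' \<phi>'' :: "real \<Rightarrow> real"
  assumes "a \<le> c" "\<kappa> > 0"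
    and d1: "\<And>u. u \<in> {a..c} \<Longrightarrow> (\<phi> has_real_derivative \<phi>' u) (at u)"
    and d2: "\<And>u. u \<in> {a..c} \<Longrightarrow> (\<phi>' has_real_derivative \<phi>'' u) (at u)"
    and big: "\<And>u. u \<in> {a..c} \<Longrightarrow> \<phi>'' u \<ge> \<kappa>"
    and nonpos: "\<phi>' c \<le> 0"
  shows "norm (integral {a..c} (\<lambda>u. cis (\<phi> u))) \<le> 5 / sqrt \<kappa>"
proof -
  have "norm (integral {-c..-a} (\<lambda>u. cis (\<phi> (- u)))) \<le> 5 / sqrt \<kappa>"
  proof (rule van_der_Corput_second_increasing)
    fix u assume "u \<in> {-c..-a}"
    then have u: "- u \<in> {a..c}"
      by auto
    show "((\<lambda>u. \<phi> (- u)) has_real_derivative - \<phi>' (- u)) (at u)"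
      using DERIV_chain2[OF d1[OF u] DERIV_minus[OF DERIV_ident]] by simp
    show "((\<lambda>u. - \<phi>' (- u)) has_real_derivative \<phi>'' (- u)) (at u)"
      using DERIV_minus[OF DERIV_chain2[OF d2[OF u] DERIV_minus[OF DERIV_ident]]] by simp
    show "\<kappa> \<le> \<phi>'' (- u)"
      using big[OF u] .
  qed (use assms in auto)
  then show ?thesis
    using Henstock_Kurzweil_Integration.integral_reflect_real[of c a "\<lambda>u. cis (\<phi> u)"] by simp
qed

text \<open>
  The derivative \<open>\<phi>'\<close> is increasing, so it changes sign at most once; cutting the interval at a
  zero of \<open>\<phi>'\<close> leaves the two one-sided situations.
\<close>

lemma van_der_Corput_second:
  fixes \<phi> \<phi>' \<phi>'' :: "real \<Rightarrow> real"
  assumes "a \<le> c" "\<kappa> > 0"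
    and d1: "\<And>u. u \<in> {a..c} \<Longrightarrow> (\<phi> has_real_derivative \<phi>' u) (at u)"
    and d2: "\<And>u. u \<in> {a..c} \<Longrightarrow> (\<phi>' has_real_derivative \<phi>'' u) (at u)"
    and big: "\<And>u. u \<in> {a..c} \<Longrightarrow> \<phi>'' u \<ge> \<kappa>"
  shows "norm (integral {a..c} (\<lambda>u. cis (\<phi> u))) \<le> 10 / sqrt \<kappa>"
proof -
  note inc = van_der_Corput_second_increasing[where \<kappa> = \<kappa> and \<phi> = \<phi> and \<phi>' = \<phi>' and \<phi>'' = \<phi>'']
  note dec = van_der_Corput_second_decreasing[where \<kappa> = \<kappa> and \<phi> = \<phi> and \<phi>' = \<phi>' and \<phi>'' = \<phi>'']
  have le: "5 / sqrt \<kappa> \<le> 10 / sqrt \<kappa>"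
    using \<open>\<kappa> > 0\<close> by (simp add: divide_right_mono)
  consider "\<phi>' a \<ge> 0" | "\<phi>' c \<le> 0" | "\<phi>' a \<le> 0" "\<phi>' c \<ge> 0"
    by linarith
  then show ?thesis
  proof cases
    case 1
    then show ?thesis
      using inc[of a c] assms le by fastforce
  next
    case 2
    then show ?thesis
      using dec[of a c] assms le by fastforce
  next
    case 3
    have "continuous_on {a..c} \<phi>'"
      using d2 by (intro DERIV_continuous_on[where D = \<phi>'']) (auto intro: has_field_derivative_at_within)
    then obtain z where z: "a \<le> z" "z \<le> c" "\<phi>' z = 0"
      using IVT'[of \<phi>' a 0 c] 3 \<open>a \<le> c\<close> by auto
    have "(\<lambda>u. cis (\<phi> u)) integrable_on {a..c}"
      using d1 by (rule integrable_cis_differentiable_phase)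
    then have "integral {a..c} (\<lambda>u. cis (\<phi> u)) =
        integral {a..z} (\<lambda>u. cis (\<phi> u)) + integral {z..c} (\<lambda>u. cis (\<phi> u))"
      using z by (simp add: Henstock_Kurzweil_Integration.integral_combine)
    also have "norm \<dots> \<le> 5 / sqrt \<kappa> + 5 / sqrt \<kappa>"
      by (intro norm_triangle_mono inc dec) (use assms z in auto)
    finally show ?thesis
      by simp
  qed
qed

section \<open>A power phase on a half-line\<close>

text \<open>
  The constant \<open>K\<close> must not depend on the truncation point \<open>R\<close>, so that \<open>R\<close> can tend to
  infinity, nor on \<open>y\<close>, which carries the decay. The cut lies at \<open>\<rho> / 2\<close>, a fixed proportion
  below the possible stationary point \<open>\<rho>\<close>: far enough from \<open>\<rho>\<close> that \<open>\<phi>'\<close> is of size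
  \<open>\<bar>y\<bar>\<close> before it, and far enough from \<open>0\<close> that \<open>\<phi>''\<close> is of size \<open>\<rho> ^ (m - 2)\<close> after it.
\<close>

lemma half_line_bound_pos:
  fixes b :: real and m :: nat
  assumes "b > 0" "m > 2"
  shows "\<exists>K>0. \<forall>y R. y \<noteq> 0 \<longrightarrow> R \<ge> 0 \<longrightarrow>
    norm (integral {0..R} (\<lambda>u. cis (y * u + b * u ^ m)))
      \<le> K / \<bar>y\<bar> powr ((real m - 2) / (2 * (real m - 1))) + 8 / \<bar>y\<bar>"
proof -
  define e where "e = (real m - 2) / (2 * (real m - 1))"
  \<comment> \<open>\<open>D\<close> is chosen so that the second derivative of the phase at \<open>\<rho> / 2\<close> is
    \<open>D * \<rho> ^ (m - 2)\<close>, and \<open>K\<close> so that \<open>10 / sqrt (D * \<rho> ^ (m - 2)) = K / \<bar>y\<bar> powr e\<close>.\<close>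
  define D where "D = real m * (real m - 1) * b / 2 ^ (m - 2)"
  define K where "K = 10 * (real m * b) powr e / sqrt D"
  have mb: "real m * b > 0"
    using assms by simp
  have "D > 0"
    using assms by (simp add: D_def)
  then have "K > 0"
    using assms unfolding K_def by (intro divide_pos_pos mult_pos_pos) auto
  moreover have "norm (integral {0..R} (\<lambda>u. cis (y * u + b * u ^ m)))
      \<le> K / \<bar>y\<bar> powr e + 8 / \<bar>y\<bar>" if "y \<noteq> 0" "R \<ge> 0" for y R
  proof -
    define \<rho> where "\<rho> = (\<bar>y\<bar> / (real m * b)) powr (1 / (real m - 1))"
    define \<phi> where "\<phi> = (\<lambda>u. y * u + b * u ^ m)"
    define \<phi>' where "\<phi>' = (\<lambda>u. y + real m * b * u ^ (m - 1))"
    define \<phi>'' where "\<phi>'' = (\<lambda>u. real m * (real m - 1) * b * u ^ (m - 2))"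
    define \<kappa> where "\<kappa> = D * \<rho> ^ (m - 2)"
    have \<rho>: "\<rho> > 0"
      using that assms by (simp add: \<rho>_def)
    have "\<kappa> > 0"
      using \<open>D > 0\<close> \<rho> by (simp add: \<kappa>_def)
    have d1: "(\<phi> has_real_derivative \<phi>' u) (at u)" for u
      unfolding \<phi>_def \<phi>'_def by (auto intro!: derivative_eq_intros)
    have d2: "(\<phi>' has_real_derivative \<phi>'' u) (at u)" for u
    proof -
      have "m - 1 - 1 = m - 2" "real (m - 1) = real m - 1"
        using assms by auto
      then show ?thesis
        unfolding \<phi>''_def \<phi>'_def by (auto intro!: derivative_eq_intros)
    qed
    have \<phi>''_mono: "\<phi>'' u \<le> \<phi>'' v" if "0 \<le> u" "u \<le> v" for u v
      unfolding \<phi>''_def using assms that by (intro mult_left_mono power_mono) auto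
    have \<rho>_pow: "real m * b * \<rho> ^ (m - 1) = \<bar>y\<bar>"
    proof -
      have "\<rho> ^ (m - 1) = \<rho> powr (real m - 1)"
        using \<rho> assms by (simp add: powr_realpow[symmetric])
      also have "\<dots> = \<bar>y\<bar> / (real m * b)"
        using assms that by (simp add: \<rho>_def powr_powr)
      finally show ?thesis
        using mb assms by simp
    qed
    have \<kappa>_eq: "10 / sqrt \<kappa> = K / \<bar>y\<bar> powr e"
    proof -
      have "sqrt (\<rho> ^ (m - 2)) = (\<rho> powr (real m - 2)) powr (1 / 2)"
        using \<rho> assms by (simp add: powr_realpow[symmetric] powr_half_sqrt)
      also have "\<dots> = (\<bar>y\<bar> / (real m * b)) powr e"
        by (simp add: \<rho>_def powr_powr e_def mult.commute)
      also have "\<dots> = \<bar>y\<bar> powr e / (real m * b) powr e"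
        by (rule powr_divide)
      finally show ?thesis
        by (simp add: \<kappa>_def real_sqrt_mult K_def)
    qed
    have near: "norm (integral {0..T} (\<lambda>u. cis (\<phi> u))) \<le> 8 / \<bar>y\<bar>" if T: "0 \<le> T" "T \<le> \<rho> / 2" for T
    proof -
      have "norm (integral {0..T} (\<lambda>u. cis (\<phi> u))) \<le> 4 / (\<bar>y\<bar> / 2)"
      proof (rule van_der_Corput_first)
        fix u assume u: "u \<in> {0..T}"
        show "0 \<le> \<phi>'' u"
          using u assms by (simp add: \<phi>''_def)
        have "u ^ (m - 1) \<le> (\<rho> / 2) ^ (m - 1)"
          using u T by (intro power_mono) auto
        also have "\<dots> \<le> \<rho> ^ (m - 1) / 2"
        proof -
          have "(2::real) ^ 1 \<le> 2 ^ (m - 1)"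
            using assms by (intro power_increasing) auto
          then show ?thesis
            using \<rho> unfolding power_divide by (intro divide_left_mono) auto
        qed
        finally have "real m * b * u ^ (m - 1) \<le> real m * b * (\<rho> ^ (m - 1) / 2)"
          using mb by (intro mult_left_mono) auto
        also have "\<dots> = \<bar>y\<bar> / 2"
          using \<rho>_pow by simp
        finally have "\<bar>real m * b * u ^ (m - 1)\<bar> \<le> \<bar>y\<bar> / 2"
          using u mb assms by simp
        then show "\<bar>y\<bar> / 2 \<le> \<bar>\<phi>' u\<bar>"
          unfolding \<phi>'_def by linarith
      qed (use d1 d2 T \<open>y \<noteq> 0\<close> in auto)
      then show ?thesis by simp
    qed
    have far: "norm (integral {\<rho> / 2..R} (\<lambda>u. cis (\<phi> u))) \<le> 10 / sqrt \<kappa>" if R: "\<rho> / 2 \<le> R"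
    proof (rule van_der_Corput_second)
      fix u assume u: "u \<in> {\<rho> / 2..R}"
      have "\<kappa> = \<phi>'' (\<rho> / 2)"
        by (simp add: \<kappa>_def \<phi>''_def D_def power_divide)
      also have "\<dots> \<le> \<phi>'' u"
        using u \<rho> by (intro \<phi>''_mono) auto
      finally show "\<kappa> \<le> \<phi>'' u" .
    qed (use d1 d2 R \<open>\<kappa> > 0\<close> in auto)
    have "norm (integral {0..R} (\<lambda>u. cis (\<phi> u))) \<le> K / \<bar>y\<bar> powr e + 8 / \<bar>y\<bar>"
    proof (cases "R \<le> \<rho> / 2")
      case True
      have "0 \<le> K / \<bar>y\<bar> powr e"
        using \<open>K > 0\<close> by simp
      then show ?thesis
        using near[of R] True that by linarith
    next
      case False
      have "(\<lambda>u. cis (\<phi> u)) integrable_on {0..R}"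
        unfolding \<phi>_def by (intro integrable_continuous_interval continuous_intros)
      then have "integral {0..R} (\<lambda>u. cis (\<phi> u)) =
          integral {0..\<rho> / 2} (\<lambda>u. cis (\<phi> u)) + integral {\<rho> / 2..R} (\<lambda>u. cis (\<phi> u))"
        using False \<rho> by (simp add: Henstock_Kurzweil_Integration.integral_combine)
      also have "norm \<dots> \<le> 8 / \<bar>y\<bar> + 10 / sqrt \<kappa>"
        using False \<rho> by (intro norm_triangle_mono near far) auto
      finally show ?thesis
        using \<kappa>_eq by simp
    qed
    then show ?thesis
      by (simp add: \<phi>_def)
  qed
  ultimately show ?thesis
    unfolding e_def by blast
qed

text \<open>
  For \<open>b < 0\<close>, conjugation changes the sign of the whole phase and keeps the modulus.
\<close>

lemma half_line_bound:
  fixes b :: real and m :: nat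
  assumes "b \<noteq> 0" "m > 2"
  shows "\<exists>K>0. \<forall>y R. y \<noteq> 0 \<longrightarrow> R \<ge> 0 \<longrightarrow>
    norm (integral {0..R} (\<lambda>u. cis (y * u + b * u ^ m)))
      \<le> K / \<bar>y\<bar> powr ((real m - 2) / (2 * (real m - 1))) + 8 / \<bar>y\<bar>"
proof (cases "b > 0")
  case True
  then show ?thesis
    using half_line_bound_pos assms by blast
next
  case False
  then obtain K where "K > 0" and K: "\<And>y R. y \<noteq> 0 \<Longrightarrow> R \<ge> 0 \<Longrightarrow>
      norm (integral {0..R} (\<lambda>u. cis (y * u + (- b) * u ^ m)))
        \<le> K / \<bar>y\<bar> powr ((real m - 2) / (2 * (real m - 1))) + 8 / \<bar>y\<bar>"
    using half_line_bound_pos[of "- b" m] assms by auto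
  have "norm (integral {0..R} (\<lambda>u. cis (y * u + b * u ^ m))) =
      norm (integral {0..R} (\<lambda>u. cis ((- y) * u + (- b) * u ^ m)))" for y R
  proof -
    have "cnj (integral {0..R} (\<lambda>u. cis (y * u + b * u ^ m))) =
        integral {0..R} (\<lambda>u. cis ((- y) * u + (- b) * u ^ m))"
      by (simp add: Henstock_Kurzweil_Integration.integral_cnj cis_cnj)
    then show ?thesis
      by (metis complex_mod_cnj)
  qed
  then show ?thesis
    using K[of "- _"] \<open>K > 0\<close> by auto
qed

section \<open>The improper integral\<close>

lemma norm_integral_UNIV_le:
  fixes f :: "real \<Rightarrow> 'a::banach"
  assumes "C \<ge> 0" and bound: "\<And>R. R \<ge> 0 \<Longrightarrow> norm (integral {-R..R} f) \<le> C"
  shows "norm (integral UNIV f) \<le> C"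
proof (cases "f integrable_on UNIV")
  case True
  show ?thesis
  proof (rule field_le_epsilon)
    fix \<epsilon> :: real assume "\<epsilon> > 0"
    obtain B where B: "B > 0"
      "\<And>a b. ball 0 B \<subseteq> {a..b} \<Longrightarrow> norm (integral {a..b} f - integral UNIV f) < \<epsilon>"
      using integrable_integral[OF True] \<open>\<epsilon> > 0\<close> unfolding has_integral_alt'[of f] by auto
    have "norm (integral {-B..B} f - integral UNIV f) < \<epsilon>"
      by (rule B(2)) (auto simp: ball_eq_greaterThanLessThan)
    moreover have "norm (integral {-B..B} f) \<le> C"
      using bound B(1) by simp
    ultimately show "norm (integral UNIV f) \<le> C + \<epsilon>"
      by norm
  qed
next
  case False
  \<comment> \<open>A divergent integral has the default value \<open>0\<close>.\<close>
  then show ?thesis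
    using \<open>C \<ge> 0\<close> by (simp add: not_integrable_integral)
qed

theorem proposition4p2:
  fixes \<beta> :: complex and m :: nat
  assumes "\<beta> \<noteq> 0" and "Re \<beta> = 0" and "m > 2"
  shows "\<exists>A B :: real. A > 0 \<and> B > 0 \<and>
    (\<forall>x::real. x \<noteq> 0 \<longrightarrow>
      norm (H m \<beta> x) \<le> A / \<bar>x\<bar> powr ((real m - 2) / (2 * (real m - 1))) + B / \<bar>x\<bar>)"
proof -
  define e where "e = (real m - 2) / (2 * (real m - 1))"
  define b where "b = - Im \<beta>"
  have "b \<noteq> 0"
    using assms by (auto simp: b_def complex_eq_iff)
  have \<beta>: "\<beta> = - \<i> * of_real b"
    using assms by (simp add: b_def complex_eq_iff)
  obtain K where "K > 0" and K: "\<And>y R. y \<noteq> 0 \<Longrightarrow> R \<ge> 0 \<Longrightarrow>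
      norm (integral {0..R} (\<lambda>u. cis (y * u + b * u ^ m))) \<le> K / \<bar>y\<bar> powr e + 8 / \<bar>y\<bar>"
    using half_line_bound[OF \<open>b \<noteq> 0\<close> \<open>m > 2\<close>] unfolding e_def by blast
  \<comment> \<open>Reflecting the negative half-line onto the positive one turns the leading coefficient
    \<open>b\<close> into \<open>(-1) ^ m * b\<close>.\<close>
  have "(-1) ^ m * b \<noteq> 0"
    using \<open>b \<noteq> 0\<close> by simp
  then obtain L where "L > 0" and L: "\<And>y R. y \<noteq> 0 \<Longrightarrow> R \<ge> 0 \<Longrightarrow>
      norm (integral {0..R} (\<lambda>u. cis (y * u + (-1) ^ m * b * u ^ m))) \<le> L / \<bar>y\<bar> powr e + 8 / \<bar>y\<bar>"
    using half_line_bound[OF _ \<open>m > 2\<close>, of "(-1) ^ m * b"] unfolding e_def by blast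
  define A where "A = (K + L) / (2 * pi)"
  define B where "B = 16 / (2 * pi)"
  have "norm (H m \<beta> x) \<le> A / \<bar>x\<bar> powr e + B / \<bar>x\<bar>" if "x \<noteq> 0" for x
  proof -
    define f where "f = (\<lambda>u. cis (- x * u + b * u ^ m))"
    define C where "C = (K + L) / \<bar>x\<bar> powr e + 16 / \<bar>x\<bar>"
    have "norm (integral UNIV f) \<le> C"
    proof (rule norm_integral_UNIV_le)
      show "C \<ge> 0"
        using \<open>K > 0\<close> \<open>L > 0\<close> by (simp add: C_def)
      fix R :: real assume "R \<ge> 0"
      have reflect: "integral {-R..0} f = integral {0..R} (\<lambda>u. cis (x * u + (-1) ^ m * b * u ^ m))"
      proof -
        have "integral {-R..0} f = integral {0..R} (\<lambda>u. f (- u))"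
          using Henstock_Kurzweil_Integration.integral_reflect_real[of 0 "-R" f] by simp
        also have "(\<lambda>u. f (- u)) = (\<lambda>u. cis (x * u + (-1) ^ m * b * u ^ m))"
        proof
          fix u :: real
          have "(- u) ^ m = (-1) ^ m * u ^ m"
            by (rule power_minus)
          then show "f (- u) = cis (x * u + (-1) ^ m * b * u ^ m)"
            by (simp add: f_def mult_ac add_ac)
        qed
        finally show ?thesis .
      qed
      have "f integrable_on {-R..R}"
        unfolding f_def by (intro integrable_continuous_interval continuous_intros)
      then have "integral {-R..R} f = integral {-R..0} f + integral {0..R} f"
        using \<open>R \<ge> 0\<close> by (simp add: Henstock_Kurzweil_Integration.integral_combine)
      also have "norm \<dots> \<le> (L / \<bar>x\<bar> powr e + 8 / \<bar>x\<bar>) + (K / \<bar>x\<bar> powr e + 8 / \<bar>x\<bar>)"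
        unfolding reflect using K[of "- x" R] L[of x R] \<open>x \<noteq> 0\<close> \<open>R \<ge> 0\<close>
        by (intro norm_triangle_mono) (auto simp: f_def)
      also have "\<dots> = C"
        by (simp add: C_def add_divide_distrib)
      finally show "norm (integral {-R..R} f) \<le> C" .
    qed
    moreover have "H m \<beta> x = 1 / (2 * of_real pi) * integral UNIV f"
    proof -
      have "(\<lambda>u::real. exp (- \<i> * of_real x * of_real u) * exp (- \<beta> * of_real u ^ m)) = f"
        by (simp add: f_def cis_conv_exp \<beta> fun_eq_iff exp_add [symmetric] ring_distribs mult.assoc)
      then show ?thesis
        by (simp add: H_def)
    qed
    ultimately have "norm (H m \<beta> x) \<le> C / (2 * pi)"
      by (simp add: norm_mult norm_divide divide_right_mono)
    also have "\<dots> = A / \<bar>x\<bar> powr e + B / \<bar>x\<bar>"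
      by (simp add: C_def A_def B_def add_divide_distrib mult.commute)
    finally show ?thesis .
  qed
  moreover have "A > 0" "B > 0"
    using \<open>K > 0\<close> \<open>L > 0\<close> by (auto simp: A_def B_def)
  ultimately show ?thesis
    unfolding e_def by blast
qed

end
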